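(* (i) Let $0<\lambda\le 1/3$, and let $q$ be an integer with $2\le q\le 1/\lambda-1$. Then $$\{(x,y):y=x^{q}\}\cap(K_\lambda\times K_\lambda)=\{(\lambda^k,\lambda^{qk}):k\in\mathbb{N}\}\cup\{(0,0),(1,1)\}.$$ (ii) For $0<\lambda\le 0.187915$, $$\{(x,y,z):x^2+y^2=z^2\}\cap(K_\lambda\times K_\lambda\times K_\lambda)=\{(x,0,x),(0,x,x):x\in K_\lambda\}.$$
   Context: $\mathbb{N}$ is the set of positive integers. For $\lambda\in(0,1/2)$, $K_\lambda\subset\mathbb{R}$ is the self-similar set generated by the iterated function system $\{f_0(x)=\lambda x,\ f_1(x)=\lambda x+1-\lambda\}$, i.e. the unique nonempty compact set with $K_\lambda=f_0(K_\lambda)\cup f_1(K_\lambda)$. In (i) and (ii) the variables $x,y,z$ range over real numbers. *)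

theory Defs
  imports "HOL-Analysis.Analysis"
begin

definition ifs0 :: "real \<Rightarrow> real \<Rightarrow> real"
  where "ifs0 lam x = lam * x"

definition ifs1 :: "real \<Rightarrow> real \<Rightarrow> real"
  where "ifs1 lam x = lam * x + 1 - lam"

definition is_attractor :: "real \<Rightarrow> real set \<Rightarrow> bool"
  where "is_attractor lam K \<longleftrightarrow>
    compact K \<and> K \<noteq> {} \<and> K = ifs0 lam ` K \<union> ifs1 lam ` K"

(* Total function; the description is only meaningful for 0 < lam < 1, where
   lemma ex1_attractor below shows that it denotes a unique set. *)
definition selfsim :: "real \<Rightarrow> real set"
  where "selfsim lam = (THE K. is_attractor lam K)"

(* Used only in the proof of existence and uniqueness. *)
definition hutch :: "real \<Rightarrow> real set \<Rightarrow> real set"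
  where "hutch lam A = ifs0 lam ` A \<union> ifs1 lam ` A"

lemma hutch_mono: "A \<subseteq> B \<Longrightarrow> hutch lam A \<subseteq> hutch lam B"
  by (auto simp: hutch_def)

lemma hutch_pow_mono: "A \<subseteq> B \<Longrightarrow> (hutch lam ^^ n) A \<subseteq> (hutch lam ^^ n) B"
  by (induction n) (auto dest: hutch_mono)

lemma hutch_fixpoint_pow: "hutch lam K = K \<Longrightarrow> (hutch lam ^^ n) K = K"
  by (induction n) auto

lemma compact_hutch:
  assumes "compact A" shows "compact (hutch lam A)"
proof -
  have "continuous_on A (ifs0 lam)" "continuous_on A (ifs1 lam)"
    by (auto simp: ifs0_def ifs1_def intro!: continuous_intros)
  then show ?thesis
    unfolding hutch_def using assms by (intro compact_Un compact_continuous_image)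
qed

lemma hutch_unit_subset:
  assumes "0 < lam" "lam < 1"
  shows "hutch lam {0..1} \<subseteq> {0..1}"
proof
  fix y assume "y \<in> hutch lam {0..1}"
  then obtain x where x: "0 \<le> x" "x \<le> 1" "y = lam * x \<or> y = lam * x + 1 - lam"
    by (auto simp: hutch_def ifs0_def ifs1_def)
  have "0 \<le> lam * x" "lam * x \<le> lam"
    using x assms by (simp_all add: mult_left_le)
  then show "y \<in> {0..1}" unfolding atLeastAtMost_iff using x(3) assms by linarith
qed

lemma attractor_in_unit:
  assumes lam: "0 < lam" "lam < 1" and K: "is_attractor lam K"
  shows "K \<subseteq> {0..1}"
proof -
  have c: "compact K" and ne: "K \<noteq> {}" and eq: "K = ifs0 lam ` K \<union> ifs1 lam ` K"
    using K by (auto simp: is_attractor_def)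
  obtain M where M: "M \<in> K" "\<And>t. t \<in> K \<Longrightarrow> t \<le> M"
    using compact_attains_sup[OF c ne] by blast
  obtain m where m: "m \<in> K" "\<And>t. t \<in> K \<Longrightarrow> m \<le> t"
    using compact_attains_inf[OF c ne] by blast
  have "M \<in> ifs0 lam ` K \<union> ifs1 lam ` K" using M eq by blast
  then obtain x where x: "x \<in> K" "M = lam * x \<or> M = lam * x + 1 - lam"
    by (auto simp: ifs0_def ifs1_def)
  have "lam * x \<le> lam * M" using M x lam by (simp add: mult_left_mono)
  then have "M \<le> lam * M + 1 - lam" using x(2) lam by linarith
  then have "(1 - lam) * M \<le> (1 - lam) * 1" by (simp add: algebra_simps)
  then have M1: "M \<le> 1" using lam by (simp add: mult_le_cancel_left)
  have "m \<in> ifs0 lam ` K \<union> ifs1 lam ` K" using m eq by blast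
  then obtain y where y: "y \<in> K" "m = lam * y \<or> m = lam * y + 1 - lam"
    by (auto simp: ifs0_def ifs1_def)
  have "lam * m \<le> lam * y" using m y lam by (simp add: mult_left_mono)
  then have "lam * m \<le> m" using y(2) lam by linarith
  then have "0 \<le> (1 - lam) * m" by (simp add: algebra_simps)
  then have "0 \<le> m" using lam by (simp add: zero_le_mult_iff)
  then show ?thesis using M1 M(2) m(2) by force
qed

lemma hutch_pow_close:
  assumes lam: "0 < lam" and a: "a \<in> {0..1}"
  shows "x \<in> (hutch lam ^^ n) {0..1} \<Longrightarrow> \<exists>y \<in> (hutch lam ^^ n) {a}. \<bar>x - y\<bar> \<le> lam ^ n"
proof (induction n arbitrary: x)
  case 0
  then show ?case using a by auto
next
  case (Suc n)
  obtain u where u: "u \<in> (hutch lam ^^ n) {0..1}" "x = ifs0 lam u \<or> x = ifs1 lam u"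
    using Suc.prems by (auto simp: hutch_def[of lam "(hutch lam ^^ n) {0..1}"])
  obtain v where v: "v \<in> (hutch lam ^^ n) {a}" "\<bar>u - v\<bar> \<le> lam ^ n"
    using Suc.IH u by blast
  have d: "\<bar>lam * u - lam * v\<bar> \<le> lam ^ Suc n"
    using v lam by (simp add: abs_mult mult_left_mono flip: right_diff_distrib)
  have "ifs0 lam v \<in> (hutch lam ^^ Suc n) {a}" "ifs1 lam v \<in> (hutch lam ^^ Suc n) {a}"
    using v by (auto simp: hutch_def)
  moreover have "\<bar>ifs0 lam u - ifs0 lam v\<bar> \<le> lam ^ Suc n"
    "\<bar>ifs1 lam u - ifs1 lam v\<bar> \<le> lam ^ Suc n"
    using d by (simp_all add: ifs0_def ifs1_def)
  ultimately show ?case using u(2) by blast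
qed

lemma attractor_eq_Inter:
  assumes lam: "0 < lam" "lam < 1" and K: "is_attractor lam K"
  shows "K = (\<Inter>n. (hutch lam ^^ n) {0..1})"
proof
  have fp: "hutch lam K = K" and c: "compact K" and ne: "K \<noteq> {}"
    using K by (auto simp: is_attractor_def hutch_def)
  note sub = attractor_in_unit[OF lam K]
  show "K \<subseteq> (\<Inter>n. (hutch lam ^^ n) {0..1})"
    using hutch_pow_mono[OF sub] hutch_fixpoint_pow[OF fp] by blast
  show "(\<Inter>n. (hutch lam ^^ n) {0..1}) \<subseteq> K"
  proof
    fix x assume x: "x \<in> (\<Inter>n. (hutch lam ^^ n) {0..1})"
    obtain a where a: "a \<in> K" using ne by blast
    have "x \<in> closure K"
      unfolding closure_approachable
    proof (intro allI impI)
      fix e :: real assume "0 < e"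
      then obtain n where n: "lam ^ n < e"
        using real_arch_pow_inv[of e lam] lam by auto
      obtain y where y: "y \<in> (hutch lam ^^ n) {a}" "\<bar>x - y\<bar> \<le> lam ^ n"
        using hutch_pow_close[of lam a x n] lam a sub x by blast
      have "(hutch lam ^^ n) {a} \<subseteq> K"
        using hutch_pow_mono[of "{a}" K n lam] a hutch_fixpoint_pow[OF fp] by auto
      then show "\<exists>y\<in>K. dist y x < e" using y n by (auto simp: dist_real_def intro!: bexI[of _ y])
    qed
    then show "x \<in> K" using c by (simp add: compact_imp_closed)
  qed
qed

lemma is_attractor_Inter:
  assumes lam: "0 < lam" "lam < 1"
  shows "is_attractor lam (\<Inter>n. (hutch lam ^^ n) {0..1})"
proof -
  define A where "A n = (hutch lam ^^ n) {0..1}" for n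
  have AS: "A (Suc n) = hutch lam (A n)" for n by (simp add: A_def)
  have comp: "compact (A n)" for n
    by (induction n) (auto simp: A_def intro: compact_hutch)
  have step: "A (Suc n) \<subseteq> A n" for n
  proof (induction n)
    case 0
    show ?case using hutch_unit_subset[OF lam] by (simp add: A_def)
  next
    case (Suc n)
    then show ?case unfolding AS[of "Suc n"] AS[of n] by (metis AS hutch_mono)
  qed
  have anti: "A n \<subseteq> A m" if "m \<le> n" for m n
    using lift_Suc_antimono_le[of A] step that by blast
  have zero: "0 \<in> A n" for n
  proof (induction n)
    case 0 show ?case by (simp add: A_def)
  next
    case (Suc n)
    then show ?case unfolding AS hutch_def ifs0_def by force
  qed
  have "compact (\<Inter>n. A n)"
    using comp by (intro compact_Inter) auto
  moreover have "(\<Inter>n. A n) \<noteq> {}" using zero by blast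
  moreover have "hutch lam (\<Inter>n. A n) = (\<Inter>n. A n)"
  proof
    have "hutch lam (\<Inter>n. A n) \<subseteq> A m" for m
      using hutch_mono[of "\<Inter>n. A n" "A m" lam] AS step by blast
    then show "hutch lam (\<Inter>n. A n) \<subseteq> (\<Inter>n. A n)" by blast
    show "(\<Inter>n. A n) \<subseteq> hutch lam (\<Inter>n. A n)"
    proof
      fix x assume x: "x \<in> (\<Inter>n. A n)"
      define u where "u = x / lam"
      define v where "v = (x - 1 + lam) / lam"
      have xu: "ifs0 lam w = x \<longleftrightarrow> w = u" "ifs1 lam w = x \<longleftrightarrow> w = v" for w
        using lam by (auto simp: ifs0_def ifs1_def u_def v_def field_simps)
      have each: "u \<in> A n \<or> v \<in> A n" for n
        using x AS[of n] xu unfolding hutch_def by (metis INT_E UNIV_I UnE imageE)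
      have "(\<forall>n. u \<in> A n) \<or> (\<forall>n. v \<in> A n)"
      proof (rule ccontr)
        assume "\<not> ?thesis"
        then obtain i j where "u \<notin> A i" "v \<notin> A j" by blast
        then show False using each[of "max i j"] anti[of i "max i j"] anti[of j "max i j"] by auto
      qed
      then show "x \<in> hutch lam (\<Inter>n. A n)"
        using xu(1)[of u] xu(2)[of v] unfolding hutch_def
        by (metis INT_I UnCI image_eqI)
    qed
  qed
  ultimately show ?thesis
    unfolding is_attractor_def A_def hutch_def[symmetric] by auto
qed

lemma ex1_attractor:
  assumes "0 < lam" "lam < 1"
  shows "\<exists>!K. is_attractor lam K"
  using is_attractor_Inter[OF assms] attractor_eq_Inter[OF assms] by blast

lemma is_attractor_selfsim:
  assumes "0 < lam" "lam < 1 / 2"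
  shows "is_attractor lam (selfsim lam)"
  unfolding selfsim_def using theI'[OF ex1_attractor] assms by simp

end

theory Submission imports Defs begin

text \<open>
  Write \<open>K\<close> for the attractor. Every positive element of \<open>K\<close> lies in \<open>[lam^n (1 - lam), lam^n]\<close> for
  some \<open>n\<close>, and every positive difference of two elements lies in \<open>[lam^n (1 - 2 lam), lam^n]\<close>.
  Both parts follow from landing in the gaps between these intervals.

  (i) Dividing by a power of \<open>lam\<close>, one may take \<open>x \<ge> 1 - lam\<close>. By symmetry \<open>u = 1 - x\<close> and
  \<open>v = 1 - x^q\<close> lie in \<open>K\<close>. If \<open>u > 0\<close>, say \<open>lam^j (1 - lam) \<le> u \<le> lam^j\<close> with \<open>j \<ge> 1\<close>, then
  \<open>u (2 - u) \<le> v < q u\<close> places \<open>v\<close> strictly between \<open>lam^j\<close> and \<open>lam^(j-1) (1 - lam)\<close>, a gap of \<open>K\<close>.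

  (ii) Dividing by a power of \<open>lam\<close>, one may take \<open>z \<ge> 1 - lam\<close>. The larger leg, say \<open>y\<close>, is then
  also at least \<open>1 - lam\<close>, and if \<open>lam^k (1 - lam) \<le> x \<le> lam^k\<close>, then \<open>z - y = x^2 / (z + y)\<close> falls
  strictly between \<open>lam^(2k+1)\<close> and \<open>lam^(2k) (1 - 2 lam)\<close>, a gap of \<open>K - K\<close>.
  The upper bound needs \<open>2 (1 - lam) (1 - 2 lam) > 1\<close>, that is, \<open>lam < (3 - sqrt 5) / 4\<close>.
\<close>

section \<open>Self-similarity, symmetry and gaps of the attractor\<close>

locale cantor_attractor =
  fixes lam :: real and K :: "real set"
  assumes lam_pos: "0 < lam" and lam_less: "lam < 1 / 2" and attractor: "is_attractor lam K"
begin

lemma bounds: "x \<in> K \<Longrightarrow> 0 \<le> x \<and> x \<le> 1"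
  using attractor_in_unit[OF lam_pos _ attractor] lam_less by fastforce

lemma attractor_eq: "K = ifs0 lam ` K \<union> ifs1 lam ` K"
  using attractor by (simp add: is_attractor_def)

lemma halves:
  assumes "x \<in> K"
  obtains t where "t \<in> K" "x = lam * t" "x \<le> lam"
  | t where "t \<in> K" "x = lam * t + 1 - lam" "1 - lam \<le> x"
proof -
  from assms have "x \<in> ifs0 lam ` K \<union> ifs1 lam ` K"
    using attractor_eq by blast
  then obtain t where t: "t \<in> K" "x = lam * t \<or> x = lam * t + 1 - lam"
    by (auto simp: ifs0_def ifs1_def)
  moreover have "0 \<le> lam * t" "lam * t \<le> lam"
    using bounds[OF t(1)] lam_pos by (simp_all add: mult_left_le)
  ultimately show thesis using that by fastforce
qed

lemma ifs0_mem: "x \<in> K \<Longrightarrow> lam * x \<in> K"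
  using attractor_eq unfolding ifs0_def by blast

lemma power_mult_mem: "x \<in> K \<Longrightarrow> lam ^ n * x \<in> K"
  by (induction n) (auto simp: mult.assoc dest: ifs0_mem)

text \<open>As \<open>t \<le> 1\<close>, each \<open>lam ^ Suc n * t\<close> is at most
  \<open>lam < 1 - lam\<close>, hence in the left piece, and a factor \<open>lam\<close> can be
  cancelled.\<close>

lemma power_mult_mem_iff:
  assumes "t \<le> 1"
  shows "lam ^ n * t \<in> K \<longleftrightarrow> t \<in> K"
proof
  show "lam ^ n * t \<in> K \<Longrightarrow> t \<in> K"
  proof (induction n)
    case (Suc n)
    have "lam ^ n * t \<le> 1"
      using lam_pos lam_less assms by (intro order_trans[OF mult_left_le power_le_one]) auto
    then have le: "lam * (lam ^ n * t) \<le> lam"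
      using lam_pos by (simp add: mult_left_le)
    have "lam * (lam ^ n * t) \<in> K" using Suc.prems by (simp add: mult.assoc)
    then show ?case
      by (cases rule: halves) (use le lam_pos lam_less Suc.IH in auto)
  qed simp
qed (rule power_mult_mem)

text \<open>Reflection about 1/2 conjugates the two maps into each other, so the reflected set is an
  attractor too, and uniqueness identifies it with \<open>K\<close>.\<close>

lemma one_minus_mem:
  assumes "x \<in> K"
  shows "1 - x \<in> K"
proof -
  let ?K = "(\<lambda>x. 1 - x) ` K"
  have conj: "ifs0 lam (1 - x) = 1 - ifs1 lam x" "ifs1 lam (1 - x) = 1 - ifs0 lam x" for x
    by (simp_all add: ifs0_def ifs1_def algebra_simps)
  have "compact ?K"
    using attractor by (intro compact_continuous_image continuous_intros) (simp add: is_attractor_def)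
  moreover have "?K \<noteq> {}" using assms by blast
  moreover have "?K = ifs0 lam ` ?K \<union> ifs1 lam ` ?K"
  proof -
    have "?K = (\<lambda>x. 1 - x) ` (ifs0 lam ` K \<union> ifs1 lam ` K)"
      by (rule arg_cong[OF attractor_eq])
    also have "\<dots> = ifs0 lam ` ?K \<union> ifs1 lam ` ?K"
      by (simp add: image_Un image_image conj Un_commute)
    finally show ?thesis .
  qed
  ultimately have "is_attractor lam ?K" by (simp add: is_attractor_def)
  then have "?K = K"
    using ex1_attractor[of lam] attractor lam_pos lam_less by auto
  then show ?thesis using assms by blast
qed

lemma zero_mem: "0 \<in> K"
proof -
  obtain x where x: "x \<in> K" using attractor by (auto simp: is_attractor_def)
  have "(\<lambda>n. lam ^ n * x) \<longlonglongrightarrow> 0"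
    using lam_pos lam_less by (intro tendsto_mult_left_zero LIMSEQ_realpow_zero) auto
  moreover have "closed K" using attractor by (simp add: is_attractor_def compact_imp_closed)
  ultimately show ?thesis
    using closed_sequentially[of K "\<lambda>n. lam ^ n * x" 0] power_mult_mem[OF x] by blast
qed

lemma one_mem: "1 \<in> K"
  using one_minus_mem[OF zero_mem] by simp

text \<open>Undoing \<open>ifs0\<close> magnifies by \<open>1 / lam\<close> while \<open>K\<close>
  is bounded by 1, so a positive point reaches the right piece after finitely many steps.\<close>

lemma renormalize:
  assumes "x \<in> K" "0 < x"
  obtains n w where "w \<in> K" "1 - lam \<le> w" "x = lam ^ n * w"
proof -
  obtain m where "lam ^ m < x"
    using real_arch_pow_inv[of x lam] assms lam_less by auto
  then have "\<exists>n w. w \<in> K \<and> 1 - lam \<le> w \<and> x = lam ^ n * w"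
    using assms(1)
  proof (induction m arbitrary: x)
    case 0
    then show ?case using bounds by fastforce
  next
    case (Suc m)
    from Suc.prems(2) show ?case
    proof (cases rule: halves)
      case (1 t)
      then have "lam ^ m < t" using Suc.prems lam_pos by simp
      then obtain n w where "w \<in> K" "1 - lam \<le> w" "t = lam ^ n * w"
        using Suc.IH 1 by blast
      then show ?thesis using 1 by (intro exI[of _ "Suc n"] exI[of _ w]) simp
    next
      case 2
      then show ?thesis using Suc.prems by (intro exI[of _ 0] exI[of _ x]) simp
    qed
  qed
  then show thesis using that by blast
qed

lemma gap:
  assumes "t \<in> K" "lam ^ Suc i < t"
  shows "lam ^ i * (1 - lam) \<le> t"
proof -
  have "0 < t" using assms(2) lam_pos by (smt (verit) zero_less_power)
  then obtain n w where w: "w \<in> K" "1 - lam \<le> w" "t = lam ^ n * w"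
    using renormalize assms by blast
  have "t \<le> lam ^ n" using w bounds lam_pos by (simp add: mult_left_le)
  then have "lam ^ Suc i < lam ^ n" using assms by simp
  then have "n \<le> i"
    using power_strict_decreasing_iff[of lam "Suc i" n] lam_pos lam_less by simp
  then have "lam ^ i \<le> lam ^ n" using lam_pos lam_less by (simp add: power_decreasing)
  then show ?thesis unfolding w(3) using w lam_pos lam_less by (intro mult_mono) auto
qed

text \<open>While both points lie in the same piece, undoing the common map magnifies their
  difference by \<open>1 / lam\<close>. Once they lie in different pieces, the middle gap of length
  \<open>1 - 2 * lam\<close> separates them.\<close>

lemma diff_scale:
  assumes "a \<in> K" "b \<in> K" "a < b"
  obtains n where "lam ^ n * (1 - 2 * lam) \<le> b - a" "b - a \<le> lam ^ n"
proof -
  obtain m where "lam ^ m < b - a"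
    using real_arch_pow_inv[of "b - a" lam] assms lam_less by auto
  then have "\<exists>n. lam ^ n * (1 - 2 * lam) \<le> b - a \<and> b - a \<le> lam ^ n"
    using assms(1,2)
  proof (induction m arbitrary: a b)
    case 0
    then show ?case using bounds[of a] bounds[of b] by simp
  next
    case (Suc m)
    have same: ?case if h: "a' \<in> K" "b' \<in> K" "b - a = lam * (b' - a')" for a' b'
    proof -
      have "lam ^ m < b' - a'" using Suc.prems h lam_pos by simp
      then obtain n where "lam ^ n * (1 - 2 * lam) \<le> b' - a'" "b' - a' \<le> lam ^ n"
        using Suc.IH h by blast
      then show ?thesis
        using h lam_pos by (intro exI[of _ "Suc n"]) (simp add: mult.assoc)
    qed
    have pos: "a < b" using Suc.prems lam_pos by (smt (verit) zero_less_power)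
    from Suc.prems(2) show ?case
    proof (cases rule: halves)
      case a: (1 a')
      from Suc.prems(3) show ?thesis
      proof (cases rule: halves)
        case (1 b')
        then show ?thesis using a same by (simp add: right_diff_distrib)
      next
        case 2
        then show ?thesis using a bounds[of a] bounds[of b] Suc.prems by (intro exI[of _ 0]) simp
      qed
    next
      case a: (2 a')
      from Suc.prems(3) show ?thesis
      proof (cases rule: halves)
        case 1
        then show ?thesis using a pos lam_less by simp
      next
        case (2 b')
        then show ?thesis using a same by (simp add: right_diff_distrib)
      qed
    qed
  qed
  then show thesis using that by blast
qed

lemma diff_gap:
  assumes "a \<in> K" "b \<in> K" "lam ^ Suc i < b - a"
  shows "lam ^ i * (1 - 2 * lam) \<le> b - a"
proof -
  have "a < b" using assms(3) lam_pos by (smt (verit) zero_less_power)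
  then obtain n where n: "lam ^ n * (1 - 2 * lam) \<le> b - a" "b - a \<le> lam ^ n"
    using diff_scale assms by blast
  then have "lam ^ Suc i < lam ^ n" using assms by simp
  then have "n \<le> i"
    using power_strict_decreasing_iff[of lam "Suc i" n] lam_pos lam_less by simp
  then have "lam ^ i * (1 - 2 * lam) \<le> lam ^ n * (1 - 2 * lam)"
    using lam_pos lam_less by (intro mult_right_mono power_decreasing) auto
  then show ?thesis using n by simp
qed

end

section \<open>Part (i): the curve y = x^q\<close>

lemma strict_Bernoulli_inequality:
  fixes u :: real
  assumes "0 < u" "u < 1" "2 \<le> q"
  shows "1 - real q * u < (1 - u) ^ q"
  using assms(3)
proof (induction q rule: nat_induct_at_least)
  case base
  then show ?case using assms by (simp add: power2_eq_square algebra_simps)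
next
  case (Suc q)
  have "1 - real (Suc q) * u \<le> (1 - u) * (1 - real q * u)"
    using assms by (simp add: algebra_simps)
  also have "\<dots> < (1 - u) * (1 - u) ^ q"
    using Suc assms by (intro mult_strict_left_mono) auto
  finally show ?case by simp
qed

context cantor_attractor
begin

lemma power_mem_renormalized:
  assumes lam: "lam \<le> 1 / 3" and q: "2 \<le> q" "real q \<le> 1 / lam - 1"
    and x: "x \<in> K" "1 - lam \<le> x" and xq: "x ^ q \<in> K"
  shows "x = 1"
proof (rule ccontr)
  assume "x \<noteq> 1"
  define u where "u = 1 - x"
  define v where "v = 1 - (1 - u) ^ q"
  have uK: "u \<in> K" and vK: "v \<in> K"
    using one_minus_mem x xq by (simp_all add: u_def v_def)
  have u0: "0 < u" and ul: "u \<le> lam"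
    using \<open>x \<noteq> 1\<close> bounds[OF x(1)] x(2) by (auto simp: u_def)
  obtain j w where w: "w \<in> K" "1 - lam \<le> w" "u = lam ^ j * w"
    using renormalize uK u0 by blast
  \<comment> \<open>A predecessor \<open>i\<close> of \<open>j\<close> is needed: the gap above
    \<open>lam ^ j\<close> ends at \<open>lam ^ i * (1 - lam)\<close>.\<close>
  have "j \<noteq> 0" using w ul lam_less by (intro notI) auto
  then obtain i where j: "j = Suc i" by (cases j) auto
  have P: "0 < lam ^ j" using lam_pos by simp
  \<comment> \<open>Equivalent to \<open>0 < 1 - 3 * lam + lam ^ 2\<close>, true for
    \<open>0 < lam \<le> 1 / 3\<close>.\<close>
  have "1 < (1 - lam) * (2 - lam)"
    using lam mult_nonneg_nonneg[of "1/3 - lam" "1/3 - lam"]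
      mult_nonneg_nonneg[of "1/3 - lam" lam] lam_pos by (simp add: algebra_simps)
  also have "\<dots> \<le> w * (2 - u)"
    using w ul lam_less by (intro mult_mono) auto
  finally have "lam ^ j < u * (2 - u)"
    using P unfolding w(3) by (simp add: mult.assoc)
  also have "u * (2 - u) = 1 - (1 - u) ^ 2" by (simp add: power2_eq_square algebra_simps)
  also have "\<dots> \<le> v"
    unfolding v_def using power_decreasing[of 2 q "1 - u"] q u0 ul lam_less by simp
  finally have "lam ^ i * (1 - lam) \<le> v" using gap[OF vK] j by simp
  \<comment> \<open>The only strict inequality in the final chain.\<close>
  moreover have "v < real q * u"
    using strict_Bernoulli_inequality[OF u0 _ q(1)] ul lam_less unfolding v_def by simp
  \<comment> \<open>The bound on \<open>q\<close> is exactly the ratio of the gap's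
    endpoints.\<close>
  moreover have "real q * u \<le> (1 / lam - 1) * lam ^ j"
    using q w(3) bounds[OF w(1)] P by (intro mult_mono) (auto simp: mult_left_le)
  moreover have "(1 / lam - 1) * lam ^ j = lam ^ i * (1 - lam)"
    using lam_pos j by (simp add: field_simps)
  ultimately show False by simp
qed

lemma power_curve:
  assumes "lam \<le> 1 / 3" "2 \<le> q" "real q \<le> 1 / lam - 1"
  shows "{(x, y). y = x ^ q} \<inter> (K \<times> K)
    = {(lam ^ k, lam ^ (q * k)) | k. 1 \<le> k} \<union> {(0, 0), (1, 1)}"
proof (intro equalityI subsetI)
  fix p assume "p \<in> {(x, y). y = x ^ q} \<inter> (K \<times> K)"
  then obtain x where p: "p = (x, x ^ q)" and x: "x \<in> K" and xq: "x ^ q \<in> K" by auto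
  show "p \<in> {(lam ^ k, lam ^ (q * k)) | k. 1 \<le> k} \<union> {(0, 0), (1, 1)}"
  proof (cases "x = 0")
    case True
    then show ?thesis using p assms by simp
  next
    case False
    then have "0 < x" using bounds[OF x] by simp
    then obtain n w where w: "w \<in> K" "1 - lam \<le> w" "x = lam ^ n * w"
      using renormalize x by blast
    have "w ^ q \<le> 1" using bounds[OF w(1)] by (simp add: power_le_one)
    moreover have "lam ^ (n * q) * w ^ q \<in> K"
      using xq w(3) by (simp add: power_mult_distrib power_mult)
    ultimately have "w ^ q \<in> K" using power_mult_mem_iff by blast
    then have "w = 1" using power_mem_renormalized assms w by blast
    then have "p = (lam ^ n, lam ^ (q * n))" using p w(3) by (simp add: power_mult mult.commute)
    \<comment> \<open>The family starts at \<open>k = 1\<close>; \<open>n = 0\<close> gives the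
      point \<open>(1, 1)\<close>.\<close>
    then show ?thesis by (cases "n = 0") auto
  qed
next
  fix p assume "p \<in> {(lam ^ k, lam ^ (q * k)) | k. 1 \<le> k} \<union> {(0, 0), (1, 1)}"
  moreover have "lam ^ k \<in> K" for k using power_mult_mem[OF one_mem] by simp
  moreover from this have "(lam ^ k) ^ q \<in> K" for k by (simp flip: power_mult)
  ultimately show "p \<in> {(x, y). y = x ^ q} \<inter> (K \<times> K)"
    using zero_mem one_mem assms(2) by (auto simp: power_mult mult.commute)
qed

section \<open>Part (ii): the Pythagorean cone\<close>

lemma no_renormalized_triple:
  assumes lam: "lam < (3 - sqrt 5) / 4"
    and K: "x \<in> K" "y \<in> K" "z \<in> K" and z: "1 - lam \<le> z"
    and eq: "x\<^sup>2 + y\<^sup>2 = z\<^sup>2" and pos: "0 < x" and xy: "x \<le> y"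
  shows False
proof -
  \<comment> \<open>\<open>11 / 5 < sqrt 5\<close> puts the threshold below
    \<open>1 / 5\<close>.\<close>
  have l: "lam < 1 / 5"
    using lam real_less_rsqrt[of "11/5" 5] by (simp add: power2_eq_square)
  have lower: "2 * lam < (1 - lam) * (1 - lam)"
    using l lam_pos mult_pos_pos[of "1/5 - lam" "1/5 - lam"] by (simp add: algebra_simps)
  \<comment> \<open>The threshold is the smaller root of
    \<open>4 * t ^ 2 - 6 * t + 1\<close>.\<close>
  have upper: "1 < 2 * (1 - lam) * (1 - 2 * lam)"
  proof -
    have "sqrt 5 < 3 - 4 * lam" using lam by simp
    then have "5 < (3 - 4 * lam)\<^sup>2" using power_strict_mono[of "sqrt 5" "3 - 4 * lam" 2] by simp
    then show ?thesis by (simp add: power2_eq_square algebra_simps)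
  qed
  have bd: "x \<le> 1" "y \<le> 1" "z \<le> 1" using bounds K by auto
  \<comment> \<open>If \<open>y \<le> lam\<close>, both legs would be too short for a hypotenuse of
    at least \<open>1 - lam\<close>.\<close>
  have "lam\<^sup>2 + lam\<^sup>2 < (1 - lam)\<^sup>2"
    using l lam_pos lower mult_left_le[of lam lam] unfolding power2_eq_square by linarith
  also have "\<dots> \<le> x\<^sup>2 + y\<^sup>2" unfolding eq using z l by (intro power_mono) auto
  also have "\<dots> \<le> y\<^sup>2 + y\<^sup>2" using xy pos by (simp add: power_mono)
  finally have "lam < y" using pos xy by (simp add: power_less_imp_less_base)
  then have y: "1 - lam \<le> y" using gap[OF K(2), of 0] by simp
  have yz: "y < z"
    using eq pos K bounds by (smt (verit) power_mono zero_less_power)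
  obtain k w where w: "w \<in> K" "1 - lam \<le> w" "x = lam ^ k * w"
    using renormalize K pos by blast
  define P where "P = lam ^ (2 * k)"
  have P: "0 < P" using lam_pos by (simp add: P_def)
  have x2: "x\<^sup>2 = P * w\<^sup>2" using w(3) by (simp add: P_def power_mult_distrib power_mult mult.commute)
  have fac: "(z - y) * (z + y) = x\<^sup>2" using eq by (simp add: power2_eq_square algebra_simps)
  \<comment> \<open>Since \<open>z + y \<le> 2\<close>, \<open>z - y\<close> is at least half of
    \<open>x ^ 2\<close>, hence beyond \<open>lam * P\<close>, the left end of the gap.\<close>
  have "P * (2 * lam) < P * ((1 - lam) * (1 - lam))" using lower P by simp
  also have "\<dots> \<le> x\<^sup>2"
    unfolding x2 unfolding power2_eq_square using P w l by (intro mult_left_mono mult_mono) auto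
  also have "\<dots> \<le> (z - y) * 2" unfolding fac[symmetric] using bd yz by (intro mult_left_mono) auto
  finally have "lam ^ Suc (2 * k) < z - y" by (simp add: P_def mult.commute)
  then have ge: "P * (1 - 2 * lam) \<le> z - y" using diff_gap K by (simp add: P_def)
  \<comment> \<open>Conversely \<open>z + y \<ge> 2 * (1 - lam)\<close>, so a difference beyond the
    gap makes \<open>x ^ 2\<close> exceed \<open>P\<close>, although
    \<open>w \<le> 1\<close>.\<close>
  have "P < P * (2 * (1 - lam) * (1 - 2 * lam))" using upper P by simp
  also have "\<dots> = P * (1 - 2 * lam) * (2 * (1 - lam))" by simp
  also have "\<dots> \<le> (z - y) * (z + y)" using ge y z yz l P by (intro mult_mono) auto
  also have "\<dots> \<le> P"
    unfolding fac x2 using w l bounds[OF w(1)] P by (simp add: mult_left_le power_le_one)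
  finally show False by simp
qed

text \<open>Homogeneity moves the hypotenuse into the right piece, and symmetry in the legs allows
  \<open>x \<le> y\<close>.\<close>

lemma no_triple:
  assumes lam: "lam < (3 - sqrt 5) / 4"
    and K: "x \<in> K" "y \<in> K" "z \<in> K"
    and eq: "x\<^sup>2 + y\<^sup>2 = z\<^sup>2" and pos: "0 < x" "0 < y"
  shows False
proof -
  have z0: "0 \<le> z" using bounds K by blast
  have xz: "x \<le> z" and yz: "y \<le> z"
    using power2_le_imp_le[of x z] power2_le_imp_le[of y z] z0
      zero_le_power2[of x] zero_le_power2[of y] eq by linarith+
  then have "0 < z" using pos by simp
  then obtain n w where w: "w \<in> K" "1 - lam \<le> w" "z = lam ^ n * w"
    using renormalize K by blast
  define a b where "a = x / lam ^ n" and "b = y / lam ^ n"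
  have P: "0 < lam ^ n" using lam_pos by simp
  have ab: "x = lam ^ n * a" "y = lam ^ n * b" using lam_pos by (simp_all add: a_def b_def)
  \<comment> \<open>The legs do not exceed the hypotenuse; this bound lets
    \<open>power_mult_mem_iff\<close> apply to them.\<close>
  have "a \<le> 1" "b \<le> 1"
    using xz yz P bounds[OF w(1)] unfolding ab w(3) by auto
  then have abK: "a \<in> K" "b \<in> K" using K power_mult_mem_iff unfolding ab by blast+
  have ab0: "0 < a" "0 < b" using pos P by (simp_all add: a_def b_def)
  have "(lam ^ n)\<^sup>2 * (a\<^sup>2 + b\<^sup>2) = (lam ^ n)\<^sup>2 * w\<^sup>2"
    using eq unfolding ab w(3) by (simp add: power_mult_distrib distrib_left)
  then have ab2: "a\<^sup>2 + b\<^sup>2 = w\<^sup>2" using lam_pos by simp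
  show False
  proof (cases "a \<le> b")
    case True
    then show ?thesis using no_renormalized_triple[OF lam abK w(1,2) ab2] ab0 by blast
  next
    case False
    then show ?thesis
      using no_renormalized_triple[OF lam abK(2,1) w(1,2)] ab2 ab0 by (simp add: add.commute)
  qed
qed

lemma pythagorean_cone:
  assumes "lam < (3 - sqrt 5) / 4"
  shows "{(x, y, z). x\<^sup>2 + y\<^sup>2 = z\<^sup>2} \<inter> (K \<times> K \<times> K)
    = {(x, 0, x) | x. x \<in> K} \<union> {(0, x, x) | x. x \<in> K}"
proof (intro equalityI subsetI)
  fix p assume "p \<in> {(x, y, z). x\<^sup>2 + y\<^sup>2 = z\<^sup>2} \<inter> (K \<times> K \<times> K)"
  then obtain x y z where p: "p = (x, y, z)" and eq: "x\<^sup>2 + y\<^sup>2 = z\<^sup>2"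
    and K: "x \<in> K" "y \<in> K" "z \<in> K" by auto
  have nonneg: "0 \<le> x" "0 \<le> y" "0 \<le> z" using bounds K by auto
  then have "x = 0 \<or> y = 0" using no_triple[OF assms K eq] by fastforce
  then show "p \<in> {(x, 0, x) | x. x \<in> K} \<union> {(0, x, x) | x. x \<in> K}"
    using eq p K nonneg by auto
qed (use zero_mem in auto)

end

theorem theorem1p3:
  shows "(\<forall>(lam::real) (q::nat).
            0 < lam \<and> lam \<le> 1 / 3 \<and> 2 \<le> q \<and> real q \<le> 1 / lam - 1 \<longrightarrow>
              {(x::real, y::real). y = x ^ q} \<inter> (selfsim lam \<times> selfsim lam)
                = {(lam ^ k, lam ^ (q * k)) | k::nat. 1 \<le> k} \<union> {(0, 0), (1, 1)}) \<and>
         (\<forall>lam::real.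
            0 < lam \<and> lam \<le> 0.187915 \<longrightarrow>
              {(x::real, y::real, z::real). x\<^sup>2 + y\<^sup>2 = z\<^sup>2}
                  \<inter> (selfsim lam \<times> selfsim lam \<times> selfsim lam)
                = {(x, 0, x) | x. x \<in> selfsim lam} \<union> {(0, x, x) | x. x \<in> selfsim lam})"
proof (intro conjI allI impI)
  fix lam :: real and q :: nat
  assume A: "0 < lam \<and> lam \<le> 1 / 3 \<and> 2 \<le> q \<and> real q \<le> 1 / lam - 1"
  then interpret cantor_attractor lam "selfsim lam"
    by unfold_locales (auto intro: is_attractor_selfsim)
  show "{(x, y). y = x ^ q} \<inter> (selfsim lam \<times> selfsim lam)
      = {(lam ^ k, lam ^ (q * k)) | k. 1 \<le> k} \<union> {(0, 0), (1, 1)}"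
    using A by (intro power_curve) auto
next
  fix lam :: real
  assume A: "0 < lam \<and> lam \<le> 0.187915"
  then interpret cantor_attractor lam "selfsim lam"
    by unfold_locales (auto intro: is_attractor_selfsim)
  \<comment> \<open>Gives \<open>(3 - sqrt 5) / 4 > 0.19 > 0.187915\<close>.\<close>
  have "sqrt 5 < 2.24" by (rule real_less_lsqrt) (auto simp: power2_eq_square)
  then show "{(x, y, z). x\<^sup>2 + y\<^sup>2 = z\<^sup>2} \<inter> (selfsim lam \<times> selfsim lam \<times> selfsim lam)
      = {(x, 0, x) | x. x \<in> selfsim lam} \<union> {(0, x, x) | x. x \<in> selfsim lam}"
    using A by (intro pythagorean_cone) auto
qed

end
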